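(* Let $n\ge 2$, $N=\{1,\dots,n\}$, and let $A=[a_{ij}]\in\mathbb{C}^{n,n}$ be a Nekrasov matrix with $$\frac{h_1(A)}{|a_{11}|}>\max_{i\ne 1}\frac{h_i(A)}{|a_{ii}|}.$$ Then $$\min\left\{\max\{\mu,1\}\max\left\{\frac{1}{\mu-\frac{h_1(A)}{|a_{11}|}},\frac{1}{1-\max\limits_{i\ne 1}\frac{h_i(A)}{|a_{ii}|}}\right\}:\ \mu\in\left(1,\frac{1-\max\limits_{i\ne 1}\frac{h_i(A)}{|a_{ii}|}}{1-\frac{h_1(A)}{|a_{11}|}}\right)\right\}=\frac{1+\frac{h_1(A)}{|a_{11}|}-\max\limits_{i\ne 1}\frac{h_i(A)}{|a_{ii}|}}{1-\max\limits_{i\ne 1}\frac{h_i(A)}{|a_{ii}|}}.$$ Furthermore, $$\|A^{-1}\|_\infty\le\frac{\max\limits_{i\in N}\frac{z_i(A)}{|a_{ii}|}\left(1+\frac{h_1(A)}{|a_{11}|}-\max\limits_{i\ne 1}\frac{h_i(A)}{|a_{ii}|}\right)}{1-\max\limits_{i\ne 1}\frac{h_i(A)}{|a_{ii}|}}<\frac{\max\limits_{i\in N}\frac{z_i(A)}{|a_{ii}|}}{1-\max\limits_{i\in N}\frac{h_i(A)}{|a_{ii}|}}.$$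
   Context: For $A=[a_{ij}]\in\mathbb{C}^{n,n}$ and $N=\{1,\dots,n\}$, define recursively $h_1(A)=\sum_{j\neq 1}|a_{1j}|$ and $h_i(A)=\sum_{j=1}^{i-1}\frac{|a_{ij}|}{|a_{jj}|}h_j(A)+\sum_{j=i+1}^{n}|a_{ij}|$ for $i=2,\dots,n$. Define $z_1(A)=1$ and $z_i(A)=\sum_{j=1}^{i-1}\frac{|a_{ij}|}{|a_{jj}|}z_j(A)+1$ for $i=2,\dots,n$. $A$ is called a Nekrasov matrix if $|a_{ii}|>h_i(A)$ for every $i\in N$. $\|\cdot\|_\infty$ is the matrix norm induced by the vector infinity norm (maximum absolute row sum). "$i\neq 1$" means $i\in N\setminus\{1\}$. *)

theory Defs
  imports Complex_Main "Jordan_Normal_Form.Matrix"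
begin

text \<open>Indices are 0-based as in \<^type>\<open>mat\<close>: row \<open>0\<close> here is row 1 of the usual notation, and
  \<open>N\<close> becomes \<open>{..<n}\<close>. For \<open>i = 0\<close> the first sum in \<open>nek_h\<close> and \<open>nek_z\<close> is empty, so the
  single recursive equation also gives the initial values \<open>h\<^sub>1\<close> and \<open>z\<^sub>1 = 1\<close>.\<close>

fun nek_h :: "complex mat \<Rightarrow> nat \<Rightarrow> real" where
  "nek_h A i = (\<Sum>j\<in>{..<i}. cmod (A $$ (i,j)) / cmod (A $$ (j,j)) * nek_h A j)
               + (\<Sum>j\<in>{i<..<dim_col A}. cmod (A $$ (i,j)))"

fun nek_z :: "complex mat \<Rightarrow> nat \<Rightarrow> real" where
  "nek_z A i = (\<Sum>j\<in>{..<i}. cmod (A $$ (i,j)) / cmod (A $$ (j,j)) * nek_z A j) + 1"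

text \<open>The unconditional equations would loop as rewrite rules.\<close>

declare nek_h.simps [simp del] nek_z.simps [simp del]

definition nekrasov_mat :: "complex mat \<Rightarrow> bool" where
  "nekrasov_mat A \<longleftrightarrow> square_mat A \<and> (\<forall>i<dim_row A. cmod (A $$ (i,i)) > nek_h A i)"

text \<open>The norms below are only meaningful for vectors and matrices of positive dimension
  (otherwise \<^const>\<open>Max\<close> is applied to the empty set).\<close>

definition linf_norm_vec :: "complex vec \<Rightarrow> real" where
  "linf_norm_vec v = Max ((\<lambda>i. cmod (v $ i)) ` {..<dim_vec v})"

definition linf_norm_mat :: "complex mat \<Rightarrow> real" where
  "linf_norm_mat A =
     (SUP v\<in>{v \<in> carrier_vec (dim_col A). linf_norm_vec v = 1}. linf_norm_vec (A *\<^sub>v v))"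

definition is_minimum :: "real \<Rightarrow> real set \<Rightarrow> bool" where
  "is_minimum c S \<longleftrightarrow> c \<in> S \<and> (\<forall>x\<in>S. c \<le> x)"

lemma linf_norm_mat_eq_row_sum:
  assumes A: "A \<in> carrier_mat m n" and m: "m > 0" and n: "n > 0"
  shows "linf_norm_mat A = (MAX i\<in>{..<m}. \<Sum>j<n. cmod (A $$ (i,j)))"
proof -
  let ?R = "\<lambda>i. \<Sum>j<n. cmod (A $$ (i,j))"
  let ?M = "MAX i\<in>{..<m}. ?R i"
  let ?V = "{v \<in> carrier_vec (dim_col A). linf_norm_vec v = 1}"
  have dims: "dim_row A = m" "dim_col A = n" using A by auto
  have entry: "(A *\<^sub>v v) $ i = (\<Sum>j<n. A $$ (i,j) * v $ j)"
    if "v \<in> carrier_vec n" "i < m" for v i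
    using that dims by (auto simp: scalar_prod_def atLeast0LessThan intro!: sum.cong)
  have le: "linf_norm_vec (A *\<^sub>v v) \<le> ?M" if "v \<in> ?V" for v
  proof -
    have v: "v \<in> carrier_vec n" and v1: "linf_norm_vec v = 1" using that dims by auto
    have vj: "cmod (v $ j) \<le> 1" if "j < n" for j
      using v1 v that unfolding linf_norm_vec_def by (metis (no_types, lifting) Max_ge
        finite_imageI finite_lessThan imageI lessThan_iff carrier_vecD)
    have "cmod ((A *\<^sub>v v) $ i) \<le> ?M" if i: "i < m" for i
    proof -
      have "cmod ((A *\<^sub>v v) $ i) \<le> (\<Sum>j<n. cmod (A $$ (i,j) * v $ j))"
        unfolding entry[OF v i] by (rule norm_sum)
      also have "\<dots> \<le> ?R i"
        by (intro sum_mono) (auto simp: norm_mult intro!: mult_left_le vj)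
      also have "\<dots> \<le> ?M" using i by (intro Max_ge) auto
      finally show ?thesis .
    qed
    then show ?thesis unfolding linf_norm_vec_def using dims m by (subst Max_le_iff) auto
  qed
  have "?M \<in> ?R ` {..<m}" using m by (intro Max_in) auto
  then obtain i where i: "i < m" and Mi: "?M = ?R i" by auto
  have ex: "\<exists>v\<in>?V. ?M \<le> linf_norm_vec (A *\<^sub>v v)"
  proof -
    let ?s = "\<lambda>j. if A $$ (i,j) = 0 then 1 else cnj (A $$ (i,j)) / cmod (A $$ (i,j))"
    let ?v = "vec n ?s"
    have s: "cmod (?s j) = 1" for j by (simp add: norm_divide)
    have "(\<lambda>j. cmod (?v $ j)) ` {..<n} = (\<lambda>j. 1) ` {..<n}"
      using s by (intro image_cong) (auto)
    then have "(\<lambda>j. cmod (?v $ j)) ` {..<n} = {1}" using n by auto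
    then have v: "?v \<in> ?V" using dims by (simp add: linf_norm_vec_def)
    have t: "A $$ (i,j) * ?s j = complex_of_real (cmod (A $$ (i,j)))" for j
      by (simp add: complex_norm_square[symmetric] power2_eq_square)
    have "(A *\<^sub>v ?v) $ i = (\<Sum>j<n. A $$ (i,j) * ?s j)"
      by (subst entry) (use i in auto)
    also have "\<dots> = complex_of_real (?R i)" unfolding t by simp
    finally have "cmod ((A *\<^sub>v ?v) $ i) = ?R i"
      by (simp only: norm_of_real) (simp add: sum_nonneg)
    moreover have "cmod ((A *\<^sub>v ?v) $ i) \<le> linf_norm_vec (A *\<^sub>v ?v)"
      unfolding linf_norm_vec_def using dims i by (intro Max_ge) auto
    ultimately show ?thesis using v Mi by force
  qed
  then obtain w where w: "w \<in> ?V" "?M \<le> linf_norm_vec (A *\<^sub>v w)" by blast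
  show ?thesis unfolding linf_norm_mat_def
  proof (rule antisym)
    show "(SUP v\<in>?V. linf_norm_vec (A *\<^sub>v v)) \<le> ?M"
      using w le by (intro cSUP_least) auto
    show "?M \<le> (SUP v\<in>?V. linf_norm_vec (A *\<^sub>v v))"
      using w le by (intro cSUP_upper2[of _ _ w]) (auto intro!: bdd_aboveI2)
  qed
qed

end

theory Submission
  imports Defs "Jordan_Normal_Form.Determinant"
begin

text \<open>
  Let \<open>A x = b\<close> with all \<open>\<bar>b\<^sub>i\<bar> \<le> c\<close>. Solving row \<open>i\<close> for \<open>x\<^sub>i\<close> and eliminating the entries
  \<open>x\<^sub>j\<close> with \<open>j < i\<close> recursively, as in Gauss--Seidel iteration, gives
  \<open>\<bar>a\<^sub>i\<^sub>i\<bar> \<bar>x\<^sub>i\<bar> \<le> c z\<^sub>i + \<beta> h\<^sub>i\<close> (lemma \<open>nekrasov_row_bound\<close>). Here \<open>\<beta>\<close> only has to bound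
  those \<open>x\<^sub>j\<close> that stand to the right of the diagonal of some row, and the first column never
  does: \<open>\<beta> = max\<^bsub>j \<noteq> 0\<^esub> \<bar>x\<^sub>j\<bar>\<close> suffices.

  With \<open>Z\<close>, \<open>r\<close>, \<open>M\<close> as in the theorem, the rows \<open>i \<noteq> 0\<close> yield \<open>\<beta> \<le> c Z + M \<beta>\<close>, hence
  \<open>\<beta> \<le> c Z / (1 - M)\<close>. Row \<open>0\<close> is the only one that sees the larger ratio \<open>r\<close>, and it sees it
  once: \<open>\<bar>x\<^sub>0\<bar> \<le> c Z + r \<beta> \<le> c Z (1 + r - M) / (1 - M)\<close>. The case \<open>c = 0\<close> shows that \<open>A\<close> is
  injective, hence invertible, and \<open>x = A\<^sup>-\<^sup>1 b\<close> turns the estimate into the bound on the norm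
  of the inverse.

  The factor in this bound is what the best column scaling
  \<open>A \<mapsto> A diag (\<mu>, 1, \<dots>, 1)\<close> gives. To the left of \<open>\<mu> = 1 + r - M\<close> the term \<open>1 / (\<mu> - r)\<close>
  dominates \<open>1 / (1 - M)\<close> and \<open>\<mu> / (\<mu> - r)\<close> decreases; to the right \<open>\<mu> / (1 - M)\<close> increases; so
  the minimum sits at the balance point (lemma \<open>scaling_minimum\<close>). The trivial scaling \<open>\<mu> = 1\<close>
  gives the factor \<open>1 / (1 - r)\<close> of the classical estimate; that the optimum is strictly smaller
  comes down to \<open>(1 + r - M) (1 - r) = 1 - M - r (r - M)\<close> with \<open>r (r - M) > 0\<close>.
\<close>

lemma nek_h_nonneg: "nek_h A i \<ge> 0"
proof (induction i rule: less_induct)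
  case (less i)
  then show ?case
    by (subst nek_h.simps) (intro add_nonneg_nonneg sum_nonneg mult_nonneg_nonneg, auto)
qed

lemma nek_z_pos: "nek_z A i > 0"
proof (induction i rule: less_induct)
  case (less i)
  have "(\<Sum>j\<in>{..<i}. cmod (A $$ (i,j)) / cmod (A $$ (j,j)) * nek_z A j) \<ge> 0"
    by (intro sum_nonneg mult_nonneg_nonneg) (auto intro: less_imp_le less)
  then show ?case by (subst nek_z.simps) simp
qed

text \<open>The recursions for \<open>h\<close> and \<open>z\<close> are exactly what is needed to push the estimates for
  \<open>j < i\<close> through row \<open>i\<close>: a bound \<open>c\<close> on the right-hand side accumulates as \<open>c z\<^sub>i\<close>, a bound
  \<open>\<beta>\<close> on the unknowns behind the diagonal as \<open>\<beta> h\<^sub>i\<close>.\<close>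

lemma nekrasov_row_bound:
  assumes A: "A \<in> carrier_mat n n" and x: "x \<in> carrier_vec n"
    and diag: "\<And>i. i < n \<Longrightarrow> A $$ (i,i) \<noteq> 0"
    and c: "\<And>i. i < n \<Longrightarrow> cmod ((A *\<^sub>v x) $ i) \<le> c"
    and \<beta>: "\<And>j. 0 < j \<Longrightarrow> j < n \<Longrightarrow> cmod (x $ j) \<le> \<beta>"
    and i: "i < n"
  shows "cmod (A $$ (i,i)) * cmod (x $ i) \<le> c * nek_z A i + \<beta> * nek_h A i"
  using i
proof (induction i rule: less_induct)
  case (less i)
  let ?a = "\<lambda>j. cmod (A $$ (i,j))"
  let ?d = "\<lambda>j. cmod (A $$ (j,j))"
  have split: "{..<n} = insert i ({..<i} \<union> {i<..<n})" using less.prems by auto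
  have row: "(A *\<^sub>v x) $ i = (\<Sum>j<n. A $$ (i,j) * x $ j)"
    using A x less.prems by (auto simp: scalar_prod_def atLeast0LessThan intro!: sum.cong)
  also have "\<dots> = A $$ (i,i) * x $ i
      + ((\<Sum>j<i. A $$ (i,j) * x $ j) + (\<Sum>j\<in>{i<..<n}. A $$ (i,j) * x $ j))"
    unfolding split by (subst sum.insert, simp, simp, subst sum.union_disjoint) auto
  finally have eq: "A $$ (i,i) * x $ i = (A *\<^sub>v x) $ i
      - (\<Sum>j<i. A $$ (i,j) * x $ j) - (\<Sum>j\<in>{i<..<n}. A $$ (i,j) * x $ j)"
    by simp
  have left: "cmod (\<Sum>j<i. A $$ (i,j) * x $ j)
      \<le> (\<Sum>j<i. ?a j / ?d j * (c * nek_z A j + \<beta> * nek_h A j))"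
  proof (rule sum_norm_le)
    fix j assume "j \<in> {..<i}"
    then have j: "j < i" "j < n" using less.prems by auto
    have "cmod (A $$ (i,j) * x $ j) = ?a j / ?d j * (?d j * cmod (x $ j))"
      using diag[OF j(2)] by (simp add: norm_mult)
    also have "\<dots> \<le> ?a j / ?d j * (c * nek_z A j + \<beta> * nek_h A j)"
      by (intro mult_left_mono less.IH j) auto
    finally show "cmod (A $$ (i,j) * x $ j) \<le> \<dots>" .
  qed
  have right: "cmod (\<Sum>j\<in>{i<..<n}. A $$ (i,j) * x $ j) \<le> (\<Sum>j\<in>{i<..<n}. ?a j * \<beta>)"
    by (rule sum_norm_le) (auto simp: norm_mult intro!: mult_left_mono \<beta>)
  have "?d i * cmod (x $ i) = cmod ((A *\<^sub>v x) $ i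
      - (\<Sum>j<i. A $$ (i,j) * x $ j) - (\<Sum>j\<in>{i<..<n}. A $$ (i,j) * x $ j))"
    unfolding eq[symmetric] by (simp add: norm_mult)
  also have "\<dots> \<le> cmod ((A *\<^sub>v x) $ i) + cmod (\<Sum>j<i. A $$ (i,j) * x $ j)
      + cmod (\<Sum>j\<in>{i<..<n}. A $$ (i,j) * x $ j)"
    by (intro order_trans[OF norm_triangle_ineq4] add_right_mono norm_triangle_ineq4)
  also have "\<dots> \<le> c + (\<Sum>j<i. ?a j / ?d j * (c * nek_z A j + \<beta> * nek_h A j))
      + (\<Sum>j\<in>{i<..<n}. ?a j * \<beta>)"
    using c[OF less.prems] left right by linarith
  also have "\<dots> = c * nek_z A i + \<beta> * nek_h A i"
    using A unfolding nek_z.simps[of A i] nek_h.simps[of A i]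
    by (simp add: algebra_simps add_divide_distrib sum.distrib sum_distrib_left)
  finally show ?case .
qed

text \<open>The hypothesis \<open>M < 1\<close> makes the inequality that bounds \<open>\<beta>\<close> by itself contractive. Row \<open>0\<close>
  enters only after \<open>\<beta>\<close> has been bounded, so its ratio contributes linearly instead of through a
  factor \<open>1 / (1 - r)\<close>.\<close>

lemma nekrasov_vec_bound:
  assumes n: "n \<ge> 2" and A: "A \<in> carrier_mat n n" and x: "x \<in> carrier_vec n"
    and diag: "\<And>i. i < n \<Longrightarrow> A $$ (i,i) \<noteq> 0"
    and c: "\<And>i. i < n \<Longrightarrow> cmod ((A *\<^sub>v x) $ i) \<le> c"
    and Z: "\<And>i. i < n \<Longrightarrow> nek_z A i / cmod (A $$ (i,i)) \<le> Z"
    and M: "\<And>i. 0 < i \<Longrightarrow> i < n \<Longrightarrow> nek_h A i / cmod (A $$ (i,i)) \<le> M"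
    and rM: "M \<le> nek_h A 0 / cmod (A $$ (0,0))" and M1: "M < 1"
    and i: "i < n"
  shows "cmod (x $ i) \<le> c * (Z * (1 + nek_h A 0 / cmod (A $$ (0,0)) - M) / (1 - M))"
proof -
  define r where "r = nek_h A 0 / cmod (A $$ (0,0))"
  define \<beta> where "\<beta> = (MAX j\<in>{1..<n}. cmod (x $ j))"
  have \<beta>: "cmod (x $ j) \<le> \<beta>" if "0 < j" "j < n" for j
    unfolding \<beta>_def using that by (intro Max_ge) auto
  have "\<beta> \<in> (\<lambda>j. cmod (x $ j)) ` {1..<n}"
    unfolding \<beta>_def using n by (intro Max_in) auto
  then obtain k where "k \<in> {1..<n}" and "\<beta> = cmod (x $ k)" by blast
  then have k: "0 < k" "k < n" "\<beta> = cmod (x $ k)" by auto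
  have \<beta>0: "\<beta> \<ge> 0" using k by simp
  have c0: "c \<ge> 0" using c[OF i] norm_ge_zero order_trans by blast
  have bound: "cmod (x $ j) \<le> c * Z + \<beta> * (nek_h A j / cmod (A $$ (j,j)))" if j: "j < n" for j
  proof -
    have "cmod (x $ j) \<le> (c * nek_z A j + \<beta> * nek_h A j) / cmod (A $$ (j,j))"
      using nekrasov_row_bound[OF A x diag c \<beta> j] diag[OF j]
      by (simp add: pos_le_divide_eq mult.commute)
    also have "\<dots> = c * (nek_z A j / cmod (A $$ (j,j))) + \<beta> * (nek_h A j / cmod (A $$ (j,j)))"
      by (simp add: add_divide_distrib)
    also have "\<dots> \<le> c * Z + \<beta> * (nek_h A j / cmod (A $$ (j,j)))"
      by (intro add_right_mono mult_left_mono Z j c0)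
    finally show ?thesis .
  qed
  \<comment> \<open>The row where \<open>\<beta>\<close> is attained is not row \<open>0\<close>, so its ratio is at most \<open>M\<close>.\<close>
  have "\<beta> \<le> c * Z + \<beta> * M"
    using bound[OF k(2)] mult_left_mono[OF M[OF k(1,2)] \<beta>0] k(3) by linarith
  then have \<beta>_le: "\<beta> \<le> c * Z / (1 - M)"
    using M1 by (simp add: pos_le_divide_eq algebra_simps)
  have r0: "r \<ge> 0" unfolding r_def by (simp add: nek_h_nonneg)
  have "cmod (x $ i) \<le> c * Z + \<beta> * r"
  proof (cases "i = 0")
    case True
    then show ?thesis using bound[OF i] by (simp add: r_def)
  next
    case False
    then have "nek_h A i / cmod (A $$ (i,i)) \<le> r" using M[of i] rM i by (simp add: r_def)
    from mult_left_mono[OF this \<beta>0] show ?thesis using bound[OF i] by linarith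
  qed
  also have "\<dots> \<le> c * Z + c * Z / (1 - M) * r"
    by (intro add_left_mono mult_right_mono \<beta>_le r0)
  also have "\<dots> = c * (Z * (1 + r - M) / (1 - M))"
    using M1 by (simp add: field_simps)
  finally show ?thesis unfolding r_def .
qed

lemma invertible_of_trivial_kernel:
  fixes A :: "'a :: field mat"
  assumes A: "A \<in> carrier_mat n n"
    and ker: "\<And>x. x \<in> carrier_vec n \<Longrightarrow> A *\<^sub>v x = 0\<^sub>v n \<Longrightarrow> x = 0\<^sub>v n"
  obtains B where "B \<in> carrier_mat n n" "A * B = 1\<^sub>m n" "B * A = 1\<^sub>m n"
proof -
  have "det A \<noteq> 0" using det_0_iff_vec_prod_zero[OF A] ker by blast
  from det_non_zero_imp_unit[OF A this, where b = "()"] that show thesis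
    by (auto simp: Units_def ring_mat_def)
qed

lemma linf_norm_mat_le:
  assumes B: "B \<in> carrier_mat m n" and m: "m > 0" and n: "n > 0"
    and le: "\<And>v i. v \<in> carrier_vec n \<Longrightarrow> (\<And>j. j < n \<Longrightarrow> cmod (v $ j) \<le> 1) \<Longrightarrow> i < m
      \<Longrightarrow> cmod ((B *\<^sub>v v) $ i) \<le> K"
  shows "linf_norm_mat B \<le> K"
  unfolding linf_norm_mat_def
proof (rule cSUP_least)
  have "(\<lambda>i. cmod (vec n (\<lambda>_. 1) $ i)) ` {..<n} = {1}" using n by force
  then have "vec n (\<lambda>_. 1) \<in> {v \<in> carrier_vec (dim_col B). linf_norm_vec v = 1}"
    using B by (simp add: linf_norm_vec_def)
  then show "{v \<in> carrier_vec (dim_col B). linf_norm_vec v = 1} \<noteq> {}" by blast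
next
  fix v assume "v \<in> {v \<in> carrier_vec (dim_col B). linf_norm_vec v = 1}"
  then have v: "v \<in> carrier_vec n" and v1: "linf_norm_vec v = 1" using B by auto
  have "cmod (v $ j) \<le> 1" if "j < n" for j
    unfolding v1[symmetric] linf_norm_vec_def using v that by (intro Max_ge) auto
  with le v have "cmod ((B *\<^sub>v v) $ i) \<le> K" if "i < m" for i using that by blast
  then show "linf_norm_vec (B *\<^sub>v v) \<le> K"
    unfolding linf_norm_vec_def using B m by (subst Max_le_iff) auto
qed

lemma scaling_minimum:
  fixes r M :: real
  assumes M0: "0 \<le> M" and Mr: "M < r" and r1: "r < 1"
  shows "is_minimum ((1 + r - M) / (1 - M))
    {max \<mu> 1 * max (1 / (\<mu> - r)) (1 / (1 - M)) | \<mu>. \<mu> \<in> {1<..<(1 - M) / (1 - r)}}"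
proof -
  let ?f = "\<lambda>\<mu>. max \<mu> 1 * max (1 / (\<mu> - r)) (1 / (1 - M))"
  have "0 < r * (r - M)" using assms by simp
  then have dom: "1 + r - M \<in> {1<..<(1 - M) / (1 - r)}"
    using assms by (simp add: pos_less_divide_eq[of "1 - r"]) (simp add: algebra_simps)
  have attained: "(1 + r - M) / (1 - M) = ?f (1 + r - M)"
    using assms by (simp add: max_def)
  have lower: "(1 + r - M) / (1 - M) \<le> ?f \<mu>" if "1 < \<mu>" for \<mu>
  proof (cases "\<mu> \<le> 1 + r - M")
    case True
    have "(1 + r - M) / (1 - M) = 1 + r / (1 - M)" using assms by (simp add: field_simps)
    also have "\<dots> \<le> 1 + r / (\<mu> - r)"
      using assms that True by (intro add_left_mono divide_left_mono) auto
    also have "\<dots> = \<mu> * (1 / (\<mu> - r))" using assms that by (simp add: field_simps)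
    also have "\<dots> \<le> ?f \<mu>" using that r1 by (intro mult_mono) auto
    finally show ?thesis .
  next
    case False
    then have "(1 + r - M) / (1 - M) \<le> \<mu> * (1 / (1 - M))"
      using assms by (simp add: divide_right_mono)
    also have "\<dots> \<le> ?f \<mu>" using that assms by (intro mult_mono) auto
    finally show ?thesis .
  qed
  show ?thesis
    unfolding is_minimum_def
  proof (intro conjI ballI)
    show "(1 + r - M) / (1 - M) \<in> {?f \<mu> | \<mu>. \<mu> \<in> {1<..<(1 - M) / (1 - r)}}"
      using dom attained by blast
  next
    fix y assume "y \<in> {?f \<mu> | \<mu>. \<mu> \<in> {1<..<(1 - M) / (1 - r)}}"
    then obtain \<mu> where "1 < \<mu>" "y = ?f \<mu>" by auto
    then show "(1 + r - M) / (1 - M) \<le> y" using lower by blast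
  qed
qed

theorem theorem10:
  fixes n :: nat and A :: "complex mat"
  assumes "n \<ge> 2"
    and "A \<in> carrier_mat n n"
    and "nekrasov_mat A"
    and "nek_h A 0 / cmod (A $$ (0,0)) > (MAX i\<in>{1..<n}. nek_h A i / cmod (A $$ (i,i)))"
  shows "let r = nek_h A 0 / cmod (A $$ (0,0));
             M = (MAX i\<in>{1..<n}. nek_h A i / cmod (A $$ (i,i)));
             Z = (MAX i\<in>{..<n}. nek_z A i / cmod (A $$ (i,i)))
         in is_minimum ((1 + r - M) / (1 - M))
              {max \<mu> 1 * max (1 / (\<mu> - r)) (1 / (1 - M)) | \<mu>. \<mu> \<in> {1<..<(1 - M) / (1 - r)}}
          \<and> (\<exists>B\<in>carrier_mat n n. inverts_mat A B \<and> inverts_mat B A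
               \<and> linf_norm_mat B \<le> Z * (1 + r - M) / (1 - M))
          \<and> Z * (1 + r - M) / (1 - M)
              < Z / (1 - (MAX i\<in>{..<n}. nek_h A i / cmod (A $$ (i,i))))"
proof -
  note n = assms(1) and A = assms(2)
  let ?q = "\<lambda>i. nek_h A i / cmod (A $$ (i,i))"
  let ?p = "\<lambda>i. nek_z A i / cmod (A $$ (i,i))"
  define r where "r = nek_h A 0 / cmod (A $$ (0,0))"
  define M where "M = (MAX i\<in>{1..<n}. ?q i)"
  define Z where "Z = (MAX i\<in>{..<n}. ?p i)"
  have dom: "nek_h A i < cmod (A $$ (i,i))" if "i < n" for i
    using assms(3) A that unfolding nekrasov_mat_def by auto
  have pos: "0 < cmod (A $$ (i,i))" if "i < n" for i
    using dom[OF that] nek_h_nonneg order.strict_trans1 by blast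
  then have diag: "A $$ (i,i) \<noteq> 0" if "i < n" for i using that by fastforce
  have Mr: "M < r" using assms(4) unfolding M_def r_def .
  have r1: "r < 1" unfolding r_def using dom[of 0] pos[of 0] n by (simp add: divide_less_eq)
  have q_le: "?q i \<le> M" if "0 < i" "i < n" for i
    unfolding M_def using that by (intro Max_ge) auto
  have M0: "0 \<le> M"
  proof -
    have "0 \<le> ?q 1" by (simp add: nek_h_nonneg)
    also have "\<dots> \<le> M" using q_le[of 1] n by simp
    finally show ?thesis .
  qed
  have p_le: "?p i \<le> Z" if "i < n" for i
    unfolding Z_def using that by (intro Max_ge) auto
  have "0 < ?p 0" using n pos[of 0] nek_z_pos by simp
  then have Z0: "0 < Z" using p_le[of 0] n by linarith
  have max_q: "(MAX i\<in>{..<n}. ?q i) = r"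
  proof (rule Max_eqI)
    fix y assume "y \<in> ?q ` {..<n}"
    then obtain i where i: "i < n" "y = ?q i" by auto
    then show "y \<le> r" using q_le[of i] Mr by (cases "i = 0") (auto simp: r_def)
  qed (use n in \<open>auto simp: r_def\<close>)
  have M1: "M < 1" using Mr r1 by simp
  have bound: "cmod (x $ i) \<le> c * (Z * (1 + r - M) / (1 - M))"
    if "x \<in> carrier_vec n" "\<And>i. i < n \<Longrightarrow> cmod ((A *\<^sub>v x) $ i) \<le> c" "i < n" for x c i
    unfolding r_def
    by (rule nekrasov_vec_bound[OF n A that(1) diag that(2) p_le q_le _ M1 that(3)])
       (use Mr in \<open>auto simp: r_def\<close>)
  have "x = 0\<^sub>v n" if x: "x \<in> carrier_vec n" "A *\<^sub>v x = 0\<^sub>v n" for x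
  proof (rule eq_vecI)
    fix i assume "i < dim_vec (0\<^sub>v n :: complex vec)"
    then have "i < n" by simp
    with bound[OF x(1), of 0 i] x(2) show "x $ i = 0\<^sub>v n $ i" by simp
  qed (use x in simp)
  then obtain B where B: "B \<in> carrier_mat n n" "A * B = 1\<^sub>m n" "B * A = 1\<^sub>m n"
    using invertible_of_trivial_kernel[OF A] by blast
  have norm_B: "linf_norm_mat B \<le> Z * (1 + r - M) / (1 - M)"
  proof (rule linf_norm_mat_le[OF B(1)])
    fix v i assume v: "v \<in> carrier_vec n" "\<And>j. j < n \<Longrightarrow> cmod (v $ j) \<le> 1" and i: "i < n"
    have "A *\<^sub>v (B *\<^sub>v v) = v"
      using assoc_mult_mat_vec[OF A B(1) v(1)] B(2) v(1) by simp
    then show "cmod ((B *\<^sub>v v) $ i) \<le> Z * (1 + r - M) / (1 - M)"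
      using bound[of "B *\<^sub>v v" 1 i] B(1) v i by simp
  qed (use n in auto)
  have "0 < r * (r - M)" using M0 Mr by simp
  then have "(1 + r - M) / (1 - M) < 1 / (1 - r)"
    using M1 r1 by (simp add: divide_simps algebra_simps)
  then have strict: "Z * (1 + r - M) / (1 - M) < Z / (1 - r)"
    using mult_strict_left_mono[OF _ Z0] by fastforce
  have "\<exists>B\<in>carrier_mat n n. inverts_mat A B \<and> inverts_mat B A
               \<and> linf_norm_mat B \<le> Z * (1 + r - M) / (1 - M)"
    using A B norm_B by (auto simp: inverts_mat_def intro!: bexI[of _ B])
  then show ?thesis
    unfolding Let_def max_q r_def[symmetric] M_def[symmetric] Z_def[symmetric]
    using scaling_minimum[OF M0 Mr r1] strict by blast
qed

end
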